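(* For every integer $k\ge 0$ and every integer $n$, we have $m_{k,n}=a_{k-n,\,k+n}$.
   Context: For nonnegative integers $k,n$, let $a_{k,n}$ be the number of ways to partition a set consisting of $k$ marked points on a line and $n$ marked points on a second line parallel to it into pairs, joining the two points of each pair by a straight segment, such that no two of these segments have a common point (in particular, no endpoint lies on another segment). This number does not depend on the positions of the points. We have $a_{0,0}=1$, and $a_{k,n}=0$ if $k+n$ is odd. By convention $a_{k,n}=0$ if $k<0$ or $n<0$. A Motzkin path is a lattice path starting at $(0,0)$ whose steps are $(1,0)$, $(1,1)$ or $(1,-1)$. The path is not required to stay above the $x$-axis. It is peakless if no step $(1,1)$ is immediately followed by a step $(1,-1)$. $m_{k,n}$ denotes the number of peakless Motzkin paths from $(0,0)$ to $(k,n)$. *)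

theory Defs
  imports "HOL-Analysis.Analysis" "HOL-Library.Disjoint_Sets"
begin

definition noncrossing_pairings :: "'a::real_vector set \<Rightarrow> 'a set set set" where
  "noncrossing_pairings S =
     {M. partition_on S M \<and> (\<forall>e\<in>M. card e = 2) \<and>
         (\<forall>p q r s. {p, q} \<in> M \<longrightarrow> {r, s} \<in> M \<longrightarrow> {p, q} \<noteq> {r, s} \<longrightarrow>
            closed_segment p q \<inter> closed_segment r s = {})}"

(* The marked points are placed at integer positions on the lines y = 0 and y = 1;
   a_num_parallel_lines below shows that any other choice gives the same number. *)
definition a_num :: "int \<Rightarrow> int \<Rightarrow> nat" where
  "a_num k n =
     (if k < 0 \<or> n < 0 then 0
      else card (noncrossing_pairings
        ((\<lambda>i. (real i, 0::real)) ` {..<nat k} \<union> (\<lambda>j. (real j, 1::real)) ` {..<nat n})))"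

(* Paths start at the origin and are represented by their lists of steps. *)
definition peakless_motzkin_paths :: "int \<Rightarrow> int \<Rightarrow> (int \<times> int) list set" where
  "peakless_motzkin_paths k n =
     {w. set w \<subseteq> {(1, 0), (1, 1), (1, -1)} \<and> sum_list w = (k, n) \<and>
         \<not> (\<exists>i. Suc i < length w \<and> w ! i = (1, 1) \<and> w ! Suc i = (1, -1))}"

definition m_num :: "int \<Rightarrow> int \<Rightarrow> nat" where
  "m_num k n = card (peakless_motzkin_paths k n)"

lemma noncrossing_pairings_image:
  fixes f :: "'a::real_vector \<Rightarrow> 'b::real_vector"
  assumes inj: "inj_on f S"
    and disj: "\<And>p q r s. p \<in> S \<Longrightarrow> q \<in> S \<Longrightarrow> r \<in> S \<Longrightarrow> s \<in> S \<Longrightarrow>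
      closed_segment p q \<inter> closed_segment r s = {} \<Longrightarrow>
      closed_segment (f p) (f q) \<inter> closed_segment (f r) (f s) = {}"
    and M: "M \<in> noncrossing_pairings S"
  shows "(`) f ` M \<in> noncrossing_pairings (f ` S)"
proof -
  have part: "partition_on S M" and c2: "\<And>e. e \<in> M \<Longrightarrow> card e = 2"
    and nc: "\<And>p q r s. {p, q} \<in> M \<Longrightarrow> {r, s} \<in> M \<Longrightarrow> {p, q} \<noteq> {r, s} \<Longrightarrow>
            closed_segment p q \<inter> closed_segment r s = {}"
    using M unfolding noncrossing_pairings_def mem_Collect_eq by (elim conjE; simp)+
  have sub: "e \<subseteq> S" if "e \<in> M" for e
    using part that by (auto simp: partition_on_def)
  have pre: "\<exists>p' q'. {p', q'} \<in> M \<and> p = f p' \<and> q = f q'" if "{p, q} \<in> (`) f ` M" for p q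
  proof -
    from that obtain e where e: "e \<in> M" "{p, q} = f ` e" by auto
    obtain x y where xy: "e = {x, y}" using c2[OF e(1)] by (auto simp: card_2_iff)
    then have "{p, q} = {f x, f y}" using e by simp
    then have "p = f x \<and> q = f y \<or> p = f y \<and> q = f x" by (auto simp: doubleton_eq_iff)
    then show ?thesis using e xy by (metis insert_commute)
  qed
  have "partition_on (f ` S) ((`) f ` M)"
  proof -
    have "(`) f ` M - {{}} = (`) f ` M"
      using part by (auto simp: partition_on_def)
    then show ?thesis using partition_on_inj_image[OF part inj] by simp
  qed
  moreover have "\<forall>e\<in>(`) f ` M. card e = 2"
    using c2 sub card_image[OF inj_on_subset[OF inj]] by force
  moreover have "closed_segment p q \<inter> closed_segment r s = {}"
    if pq: "{p, q} \<in> (`) f ` M" "{r, s} \<in> (`) f ` M" "{p, q} \<noteq> {r, s}" for p q r s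
  proof -
    obtain p' q' where 1: "{p', q'} \<in> M" "p = f p'" "q = f q'" using pre[OF pq(1)] by blast
    obtain r' s' where 2: "{r', s'} \<in> M" "r = f r'" "s = f s'" using pre[OF pq(2)] by blast
    have "{p', q'} \<noteq> {r', s'}"
      using pq(3) unfolding 1(2,3) 2(2,3) by (metis image_empty image_insert)
    then have d: "closed_segment p' q' \<inter> closed_segment r' s' = {}" by (rule nc[OF 1(1) 2(1)])
    have S: "p' \<in> S" "q' \<in> S" "r' \<in> S" "s' \<in> S" using sub[OF 1(1)] sub[OF 2(1)] by auto
    show ?thesis unfolding 1(2,3) 2(2,3) by (rule disj[OF S d])
  qed
  ultimately show ?thesis by (simp add: noncrossing_pairings_def)
qed

lemma finite_noncrossing_pairings: "finite S \<Longrightarrow> finite (noncrossing_pairings S)"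
  by (rule finite_subset[OF _ finitely_many_partition_on[of S]])
    (auto simp: noncrossing_pairings_def)

lemma card_noncrossing_pairings_le:
  fixes f :: "'a::real_vector \<Rightarrow> 'b::real_vector"
  assumes inj: "inj_on f S" and fin: "finite S"
    and disj: "\<And>p q r s. p \<in> S \<Longrightarrow> q \<in> S \<Longrightarrow> r \<in> S \<Longrightarrow> s \<in> S \<Longrightarrow>
      closed_segment p q \<inter> closed_segment r s = {} \<Longrightarrow>
      closed_segment (f p) (f q) \<inter> closed_segment (f r) (f s) = {}"
  shows "card (noncrossing_pairings S) \<le> card (noncrossing_pairings (f ` S))"
proof (rule card_inj_on_le)
  have sub: "M \<in> Pow (Pow S)" if "M \<in> noncrossing_pairings S" for M
    using that by (auto simp: noncrossing_pairings_def partition_on_def)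
  show "inj_on (\<lambda>M. (`) f ` M) (noncrossing_pairings S)"
    by (rule inj_on_subset[OF inj_on_image_Pow[OF inj_on_image_Pow[OF inj]]]) (use sub in blast)
  show "(\<lambda>M. (`) f ` M) ` noncrossing_pairings S \<subseteq> noncrossing_pairings (f ` S)"
    by (intro image_subsetI noncrossing_pairings_image[OF inj]) (rule disj)
  show "finite (noncrossing_pairings (f ` S))"
    using fin by (simp add: finite_noncrossing_pairings)
qed

lemma card_noncrossing_pairings_eq:
  fixes f :: "'a::real_vector \<Rightarrow> 'b::real_vector"
  assumes inj: "inj_on f S" and fin: "finite S"
    and disj: "\<And>p q r s. p \<in> S \<Longrightarrow> q \<in> S \<Longrightarrow> r \<in> S \<Longrightarrow> s \<in> S \<Longrightarrow>
      closed_segment p q \<inter> closed_segment r s = {} \<longleftrightarrow>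
      closed_segment (f p) (f q) \<inter> closed_segment (f r) (f s) = {}"
  shows "card (noncrossing_pairings S) = card (noncrossing_pairings (f ` S))"
proof (rule antisym)
  show "card (noncrossing_pairings S) \<le> card (noncrossing_pairings (f ` S))"
    using card_noncrossing_pairings_le[OF inj fin] disj by blast
  let ?g = "inv_into S f"
  have g: "?g ` f ` S = S" "\<And>x. x \<in> S \<Longrightarrow> ?g (f x) = x"
    using inj by (auto simp: image_image)
  have "card (noncrossing_pairings (f ` S)) \<le> card (noncrossing_pairings (?g ` f ` S))"
  proof (rule card_noncrossing_pairings_le)
    show "inj_on ?g (f ` S)" by (rule inj_on_inv_into) simp
    show "finite (f ` S)" using fin by simp
    fix p q r s
    assume "p \<in> f ` S" "q \<in> f ` S" "r \<in> f ` S" "s \<in> f ` S"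
      and d: "closed_segment p q \<inter> closed_segment r s = {}"
    then obtain p' q' r' s' where S: "p' \<in> S" "q' \<in> S" "r' \<in> S" "s' \<in> S"
      and e: "p = f p'" "q = f q'" "r = f r'" "s = f s'"
      by blast
    show "closed_segment (?g p) (?g q) \<inter> closed_segment (?g r) (?g s) = {}"
      using disj[OF S] d unfolding e by (simp only: g(2) S simp_thms)
  qed
  then show "card (noncrossing_pairings (f ` S)) \<le> card (noncrossing_pairings S)"
    using g by simp
qed

(* For points on the lines y = 0 and y = 1, segments are disjoint iff one of them lies strictly
   to the left of the other, as far as endpoints on the same line are concerned. *)
definition left_of :: "real \<times> real \<Rightarrow> real \<times> real \<Rightarrow> real \<times> real \<Rightarrow> real \<times> real \<Rightarrow> bool" where
  "left_of p q r s \<longleftrightarrow> (\<forall>x\<in>{p, q}. \<forall>y\<in>{r, s}. snd x = snd y \<longrightarrow> fst x < fst y)"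

lemma segment_same_line:
  "closed_segment (s, b) (t, b) = closed_segment s t \<times> {b}" for s t b :: real
proof -
  have "(x, y) \<in> closed_segment (s, b) (t, b) \<longleftrightarrow> (x, y) \<in> closed_segment s t \<times> {b}" for x y
    by (auto simp: in_segment algebra_simps)
  then show ?thesis by auto
qed

lemma segment_two_lines:
  "closed_segment (s, 0) (t, 1) = {((1 - a) * s + a * t, a) | a. 0 \<le> a \<and> a \<le> 1}" for s t :: real
  by (auto simp: in_segment)

lemma two_lines_disjoint_iff:
  fixes s t s' t' :: real
  shows "closed_segment (s, 0::real) (t, 1) \<inter> closed_segment (s', 0) (t', 1) = {} \<longleftrightarrow>
    s < s' \<and> t < t' \<or> s' < s \<and> t' < t"
proof -
  have *: "closed_segment (s, 0::real) (t, 1) \<inter> closed_segment (s', 0) (t', 1) = {} \<longleftrightarrow>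
    (\<forall>a. 0 \<le> a \<and> a \<le> 1 \<longrightarrow> (1 - a) * (s - s') + a * (t - t') \<noteq> 0)"
    unfolding segment_two_lines by (auto simp: algebra_simps)
  have neg: "(1 - a) * x + a * y < 0" if "x < 0" "y < 0" "0 \<le> a" "a \<le> 1" for a x y :: real
    using convex_bound_lt[of x 0 y "1 - a" a] that by simp
  have zero: "\<exists>a. 0 \<le> a \<and> a \<le> 1 \<and> (1 - a) * x + a * y = 0" if "x \<ge> 0" "y \<le> 0" for x y :: real
  proof (cases "x = y")
    case True
    then show ?thesis using that by (intro exI[of _ 0]) auto
  next
    case False
    then have "x - y > 0" using that by simp
    then show ?thesis
      using that by (intro exI[of _ "x / (x - y)"]) (auto simp: field_simps)
  qed
  have zero': "\<exists>a. 0 \<le> a \<and> a \<le> 1 \<and> (1 - a) * x + a * y = 0" if "x \<le> 0" "y \<ge> 0" for x y :: real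
    using zero[of "- x" "- y"] that by (auto simp: algebra_simps)
  show ?thesis
  proof
    assume "closed_segment (s, 0::real) (t, 1) \<inter> closed_segment (s', 0) (t', 1) = {}"
    then show "s < s' \<and> t < t' \<or> s' < s \<and> t' < t"
      unfolding * using zero[of "s - s'" "t - t'"] zero'[of "s - s'" "t - t'"] by force
  next
    assume "s < s' \<and> t < t' \<or> s' < s \<and> t' < t"
    then have "(1 - a) * (s - s') + a * (t - t') \<noteq> 0" if "0 \<le> a" "a \<le> 1" for a
    proof
      assume "s < s' \<and> t < t'"
      then show ?thesis using neg[of "s - s'" "t - t'" a] that by simp
    next
      assume "s' < s \<and> t' < t"
      then have "(1 - a) * (s' - s) + a * (t' - t) < 0" using neg[of "s' - s" "t' - t" a] that by simp
      moreover have "(1 - a) * (s' - s) + a * (t' - t) = - ((1 - a) * (s - s') + a * (t - t'))"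
        by (simp add: algebra_simps)
      ultimately show ?thesis by linarith
    qed
    then show "closed_segment (s, 0::real) (t, 1) \<inter> closed_segment (s', 0) (t', 1) = {}"
      unfolding * by blast
  qed
qed

lemma left_of_commute: "left_of p q r s = left_of q p r s" "left_of p q r s = left_of p q s r"
  by (auto simp: left_of_def)

lemma closed_segment_real_disjoint_iff:
  fixes a b c d :: real
  shows "closed_segment a b \<inter> closed_segment c d = {} \<longleftrightarrow>
    (a < c \<and> a < d \<and> b < c \<and> b < d) \<or> (c < a \<and> c < b \<and> d < a \<and> d < b)"
  by (simp add: closed_segment_eq_real_ivl) linarith

lemma segment_levels_disjoint_iff:
  fixes x y z w b c :: real
  shows "closed_segment (x, b) (y, b) \<inter> closed_segment (z, c) (w, c) = {} \<longleftrightarrow>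
    left_of (x, b) (y, b) (z, c) (w, c) \<or> left_of (z, c) (w, c) (x, b) (y, b)"
  by (cases "b = c")
    (auto simp: segment_same_line left_of_def Times_Int_Times closed_segment_real_disjoint_iff)

lemma segment_mixed_disjoint_iff:
  fixes x y z w b c :: real
  assumes "b \<in> {0, 1}"
  shows "closed_segment (x, b) (y, b) \<inter> closed_segment (z, 0) (w, 1) = {} \<longleftrightarrow>
    left_of (x, b) (y, b) (z, 0) (w, 1) \<or> left_of (z, 0) (w, 1) (x, b) (y, b)"
proof -
  define v where "v = (1 - b) * z + b * w"
  have v: "v = (if b = 0 then z else w)" using assms by (auto simp: v_def)
  have in1: "(t, a) \<in> closed_segment (x, b) (y, b) \<longleftrightarrow> t \<in> closed_segment x y \<and> a = b" for t a
    by (auto simp: segment_same_line)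
  have in2: "(t, a) \<in> closed_segment (z, 0) (w, 1) \<longleftrightarrow> t = (1 - a) * z + a * w \<and> 0 \<le> a \<and> a \<le> 1"
    for t a :: real
    unfolding segment_two_lines by blast
  have "closed_segment (x, b) (y, b) \<inter> closed_segment (z, 0) (w, 1) = {} \<longleftrightarrow>
      \<not> (v \<in> closed_segment x y \<and> 0 \<le> b \<and> b \<le> 1)"
    unfolding disjoint_iff split_paired_All in1 in2 v_def by blast
  also have "\<dots> \<longleftrightarrow> v \<notin> closed_segment x y" using assms by auto
  also have "\<dots> \<longleftrightarrow> x < v \<and> y < v \<or> v < x \<and> v < y"
    using closed_segment_real_disjoint_iff[of x y v v] by auto
  also have "\<dots> \<longleftrightarrow> left_of (x, b) (y, b) (z, 0) (w, 1) \<or> left_of (z, 0) (w, 1) (x, b) (y, b)"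
    using assms unfolding v left_of_def by auto
  finally show ?thesis .
qed

lemma segments_disjoint_iff:
  assumes "snd p \<in> {0, 1}" "snd q \<in> {0, 1}" "snd r \<in> {0, 1}" "snd s \<in> {0, 1}"
  shows "closed_segment p q \<inter> closed_segment r s = {} \<longleftrightarrow> left_of p q r s \<or> left_of r s p q"
proof -
  let ?D = "\<lambda>p q r s. closed_segment p q \<inter> closed_segment r s = {} \<longleftrightarrow>
    left_of p q r s \<or> left_of r s p q"
  have sym: "?D p q r s \<longleftrightarrow> ?D q p r s" "?D p q r s \<longleftrightarrow> ?D p q s r" "?D p q r s \<longleftrightarrow> ?D r s p q"
    for p q r s
    by (auto simp: left_of_commute closed_segment_commute Int_commute)
  have both: "?D (x, 0) (y, 1) (z, 0) (w, 1)" for x y z w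
    by (auto simp: two_lines_disjoint_iff left_of_def)
  have main: "?D (x, b) (y, b') (z, c) (w, c')"
    if levels: "(b, b') \<in> {(0, 0), (1, 1), (0, 1)}" "(c, c') \<in> {(0, 0), (1, 1), (0, 1)}"
    for x y z w b b' c c'
  proof -
    consider "b = b'" "c = c'" | "b = b'" "b \<in> {0, 1}" "c = 0" "c' = 1"
      | "c = c'" "c \<in> {0, 1}" "b = 0" "b' = 1" | "b = 0" "b' = 1" "c = 0" "c' = 1"
      using levels by auto
    then show ?thesis
    proof cases
      case 1
      then show ?thesis by (simp only: segment_levels_disjoint_iff)
    next
      case 2
      show ?thesis unfolding 2(1)[symmetric] 2(3,4) by (rule segment_mixed_disjoint_iff[OF 2(2)])
    next
      case 3
      show ?thesis unfolding sym(3)[of "(x, b)"] unfolding 3(1)[symmetric] 3(3,4)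
        by (rule segment_mixed_disjoint_iff[OF 3(2)])
    next
      case 4
      show ?thesis unfolding 4 by (rule both)
    qed
  qed
  have main1: "?D p q (z, c) (w, c')"
    if "snd p \<in> {0, 1}" "snd q \<in> {0, 1}" "(c, c') \<in> {(0, 0), (1, 1), (0, 1)}" for p q z w c c'
    using that main[of "snd p" "snd q" c c' "fst p" "fst q" z w]
      main[of "snd q" "snd p" c c' "fst q" "fst p" z w] sym(1)[of p q "(z, c)" "(w, c')"]
    by auto
  show ?thesis
    using assms main1[of p q "snd r" "snd s" "fst r" "fst s"]
      main1[of p q "snd s" "snd r" "fst s" "fst r"] sym(2)[of p q r s]
    by auto
qed

lemma strict_mono_enumeration:
  fixes P :: "real set"
  assumes "finite P"
  obtains h :: "nat \<Rightarrow> real"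
  where "h ` {..<card P} = P"
    and "\<And>i j. i < card P \<Longrightarrow> j < card P \<Longrightarrow> h i < h j \<longleftrightarrow> i < j"
proof
  let ?h = "\<lambda>i. sorted_list_of_set P ! i"
  have len: "length (sorted_list_of_set P) = card P" by simp
  show "?h ` {..<card P} = P"
    using assms len nth_image[of "card P" "sorted_list_of_set P"] by (simp add: lessThan_atLeast0)
  have "?h i < ?h j" if "i < j" "j < card P" for i j
    using that assms len strict_sorted_list_of_set[of P] sorted_wrt_nth_less by metis
  then show "?h i < ?h j \<longleftrightarrow> i < j" if "i < card P" "j < card P" for i j
    using that by (metis less_asym linorder_neqE_nat less_irrefl)
qed

lemma a_num_parallel_lines:
  fixes c d u :: "'a::real_vector"
  assumes lines: "u \<noteq> 0" "d - c \<notin> span {u}"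
    and fin: "finite P" "finite Q"
    and P: "P \<subseteq> {c + t *\<^sub>R u | t. True}" and Q: "Q \<subseteq> {d + t *\<^sub>R u | t. True}"
  shows "card (noncrossing_pairings (P \<union> Q)) = a_num (int (card P)) (int (card Q))"
proof -
  define L where "L = (\<lambda>x :: real \<times> real. c + (fst x *\<^sub>R u + snd x *\<^sub>R (d - c)))"
  have lin: "linear (\<lambda>x :: real \<times> real. fst x *\<^sub>R u + snd x *\<^sub>R (d - c))"
    by (rule linearI) (auto simp: algebra_simps)
  have "inj (\<lambda>x :: real \<times> real. fst x *\<^sub>R u + snd x *\<^sub>R (d - c))"
    unfolding linear_injective_0[OF lin]
  proof (intro allI impI)
    fix x :: "real \<times> real"
    assume x: "fst x *\<^sub>R u + snd x *\<^sub>R (d - c) = 0"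
    have "snd x = 0"
    proof (rule ccontr)
      assume nz: "snd x \<noteq> 0"
      have "snd x *\<^sub>R (d - c) = (- fst x) *\<^sub>R u" using x by (simp add: add_eq_0_iff2)
      then have "(1 / snd x) *\<^sub>R (snd x *\<^sub>R (d - c)) = (1 / snd x) *\<^sub>R ((- fst x) *\<^sub>R u)" by simp
      then have "d - c = (- fst x / snd x) *\<^sub>R u" using nz by simp
      then show False using lines(2) by (metis span_base span_scale insertI1)
    qed
    then show "x = 0" using x lines(1) by (simp add: prod_eq_iff)
  qed
  then have injL: "inj L" unfolding L_def by (auto simp: inj_def)
  have segL: "closed_segment (L x) (L y) = L ` closed_segment x y" for x y
    unfolding L_def closed_segment_translation closed_segment_linear_image[OF lin] image_image ..
  define P' Q' where "P' = {t. c + t *\<^sub>R u \<in> P}" and "Q' = {t. d + t *\<^sub>R u \<in> Q}"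
  have injP: "inj (\<lambda>t. c + t *\<^sub>R u)" "inj (\<lambda>t. d + t *\<^sub>R u)" using lines(1) by (auto simp: inj_def)
  have PP: "P = (\<lambda>t. c + t *\<^sub>R u) ` P'" "Q = (\<lambda>t. d + t *\<^sub>R u) ` Q'"
    using P Q by (auto simp: P'_def Q'_def)
  have cards: "card P' = card P" "card Q' = card Q" 
    unfolding PP using injP by (auto intro!: card_image[symmetric] intro: inj_on_subset)
  have fin': "finite P'" "finite Q'"
    using fin unfolding PP by (auto dest!: finite_imageD intro: inj_on_subset[OF injP(1)] inj_on_subset[OF injP(2)])
  obtain h1 where h1: "h1 ` {..<card P'} = P'"
    "\<And>i j. i < card P' \<Longrightarrow> j < card P' \<Longrightarrow> h1 i < h1 j \<longleftrightarrow> i < j"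
    using strict_mono_enumeration[OF fin'(1)] by blast
  obtain h2 where h2: "h2 ` {..<card Q'} = Q'"
    "\<And>i j. i < card Q' \<Longrightarrow> j < card Q' \<Longrightarrow> h2 i < h2 j \<longleftrightarrow> i < j"
    using strict_mono_enumeration[OF fin'(2)] by blast
  define S where "S = (\<lambda>i. (real i, 0::real)) ` {..<card P'} \<union> (\<lambda>j. (real j, 1::real)) ` {..<card Q'}"
  define h where "h = (\<lambda>x :: real \<times> real.
    (if snd x = 0 then h1 (nat \<lfloor>fst x\<rfloor>) else h2 (nat \<lfloor>fst x\<rfloor>), snd x))"
  have snd_h: "snd (h x) = snd x" for x by (simp add: h_def)
  have mono: "fst (h x) < fst (h y) \<longleftrightarrow> fst x < fst y" if "x \<in> S" "y \<in> S" "snd x = snd y" for x y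
    using that h1(2) h2(2) by (auto simp: S_def h_def)
  have snd_S: "snd x \<in> {0, 1}" if "x \<in> S" for x using that by (auto simp: S_def)
  have injh: "inj_on h S"
  proof (rule inj_onI)
    fix x y assume xy: "x \<in> S" "y \<in> S" "h x = h y"
    then have "snd x = snd y" by (metis snd_h)
    then show "x = y" using mono[of x y] mono[of y x] xy by (auto simp: prod_eq_iff)
  qed
  have left: "left_of (h p) (h q) (h r) (h s) \<longleftrightarrow> left_of p q r s"
    if "p \<in> S" "q \<in> S" "r \<in> S" "s \<in> S" for p q r s
    using that mono by (auto simp: left_of_def snd_h)
  have "card (noncrossing_pairings S) = card (noncrossing_pairings ((L \<circ> h) ` S))"
  proof (rule card_noncrossing_pairings_eq)
    show "inj_on (L \<circ> h) S" using injh injL by (auto intro: comp_inj_on inj_on_subset)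
    show "finite S" by (simp add: S_def)
    fix p q r s assume S: "p \<in> S" "q \<in> S" "r \<in> S" "s \<in> S"
    have "closed_segment (L (h p)) (L (h q)) \<inter> closed_segment (L (h r)) (L (h s)) = {} \<longleftrightarrow>
      closed_segment (h p) (h q) \<inter> closed_segment (h r) (h s) = {}"
      unfolding segL image_Int[OF injL, symmetric] by simp
    also have "\<dots> \<longleftrightarrow> left_of (h p) (h q) (h r) (h s) \<or> left_of (h r) (h s) (h p) (h q)"
      by (rule segments_disjoint_iff) (use snd_S S snd_h in metis)+
    also have "\<dots> \<longleftrightarrow> closed_segment p q \<inter> closed_segment r s = {}"
      using left S segments_disjoint_iff[of p q r s] snd_S by metis
    finally show "closed_segment p q \<inter> closed_segment r s = {} \<longleftrightarrow>
      closed_segment ((L \<circ> h) p) ((L \<circ> h) q) \<inter> closed_segment ((L \<circ> h) r) ((L \<circ> h) s) = {}"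
      by simp
  qed
  also have "(L \<circ> h) ` S = P \<union> Q"
  proof -
    have "L (h (real i, 0)) = c + h1 i *\<^sub>R u" "L (h (real i, 1)) = d + h2 i *\<^sub>R u" for i
      by (simp_all add: L_def h_def)
    then have "(L \<circ> h) ` S = (\<lambda>t. c + t *\<^sub>R u) ` h1 ` {..<card P'} \<union> (\<lambda>t. d + t *\<^sub>R u) ` h2 ` {..<card Q'}"
      unfolding S_def by (simp add: image_Un image_image)
    then show ?thesis using h1(1) h2(1) PP by simp
  qed
  also have "card (noncrossing_pairings S) = a_num (int (card P)) (int (card Q))"
    by (simp add: a_num_def S_def cards)
  finally show ?thesis by simp
qed

end

theory Submission
  imports Defs
begin

text \<open>Write \<open>x = k - n\<close>, \<open>y = k + n\<close> and \<open>a = a_num\<close>. Unless the last points of the two lines are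
  paired with each other, at least one of them is paired with its neighbour on the same line, so
  inclusion-exclusion gives
  \<open>a x y + a (x - 2) (y - 2) = a (x - 2) y + a x (y - 2) + a (x - 1) (y - 1)\<close>.
  Removing the first step of a peakless path gives the same recurrence, since an up step can be
  prepended unless the path starts with a down step.\<close>

section \<open>The recurrence for pairings\<close>

lemma noncrossing_pairingsD:
  assumes "M \<in> noncrossing_pairings S"
  shows "partition_on S M" and "\<And>e. e \<in> M \<Longrightarrow> card e = 2"
    and "\<And>p q r s. {p, q} \<in> M \<Longrightarrow> {r, s} \<in> M \<Longrightarrow> {p, q} \<noteq> {r, s} \<Longrightarrow>
            closed_segment p q \<inter> closed_segment r s = {}"
  using assms unfolding noncrossing_pairings_def mem_Collect_eq by (elim conjE; simp)+

lemma noncrossing_pairings_partner: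
  assumes "M \<in> noncrossing_pairings S" "p \<in> S"
  obtains q where "{p, q} \<in> M" "q \<in> S" "q \<noteq> p"
proof -
  note D = noncrossing_pairingsD[OF assms(1)]
  obtain e where e: "e \<in> M" "p \<in> e" using D(1) assms(2) by (auto simp: partition_on_def)
  then obtain a b where ab: "e = {a, b}" "a \<noteq> b" using D(2) by (metis card_2_iff)
  have "e \<subseteq> S" using D(1) e by (auto simp: partition_on_def)
  then show ?thesis using that[of a] that[of b] e ab by (auto simp: insert_commute)
qed

lemma noncrossing_pairings_common_point:
  assumes "M \<in> noncrossing_pairings S" "e \<in> M" "f \<in> M" "p \<in> e" "p \<in> f"
  shows "e = f"
proof -
  have "disjoint M" using noncrossing_pairingsD(1)[OF assms(1)] by (simp add: partition_on_def)
  then show ?thesis using assms by (auto simp: disjoint_def)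
qed

text \<open>An edge that meets no segment between the remaining points imposes no condition on them.
  So the pairings through this edge arise by adding it to arbitrary noncrossing pairings of the
  rest.\<close>

lemma noncrossing_pairings_containing_edge:
  assumes "p \<noteq> q" "{p, q} \<subseteq> S"
    and sep: "\<And>r s. r \<in> S - {p, q} \<Longrightarrow> s \<in> S - {p, q} \<Longrightarrow>
      closed_segment p q \<inter> closed_segment r s = {}"
  shows "{M \<in> noncrossing_pairings S. {p, q} \<in> M} = insert {p, q} ` noncrossing_pairings (S - {p, q})"
proof (intro equalityI subsetI)
  fix M assume "M \<in> {M \<in> noncrossing_pairings S. {p, q} \<in> M}"
  then have M: "M \<in> noncrossing_pairings S" "{p, q} \<in> M" by auto
  note D = noncrossing_pairingsD[OF M(1)]
  have "partition_on (S - {p, q}) (M - {{p, q}})"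
  proof (rule partition_onI)
    show "\<Union> (M - {{p, q}}) = S - {p, q}"
    proof (intro equalityI subsetI)
      fix t assume "t \<in> \<Union> (M - {{p, q}})"
      then obtain e where e: "e \<in> M" "e \<noteq> {p, q}" "t \<in> e" by auto
      then have "t \<in> S" using D(1) by (auto simp: partition_on_def)
      moreover have "t \<notin> {p, q}" using noncrossing_pairings_common_point[OF M(1) e(1) M(2) e(3)] e(2) by blast
      ultimately show "t \<in> S - {p, q}" by blast
    qed (use D(1) in \<open>auto simp: partition_on_def\<close>)
  qed (use D(1) in \<open>auto simp: partition_on_def disjoint_def disjnt_def\<close>)
  then have "M - {{p, q}} \<in> noncrossing_pairings (S - {p, q})"
    using D(2,3) by (auto simp: noncrossing_pairings_def)
  then show "M \<in> insert {p, q} ` noncrossing_pairings (S - {p, q})"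
    using M(2) by (intro image_eqI[of _ _ "M - {{p, q}}"]) auto
next
  fix M assume "M \<in> insert {p, q} ` noncrossing_pairings (S - {p, q})"
  then obtain N where N: "N \<in> noncrossing_pairings (S - {p, q})" "M = insert {p, q} N" by blast
  note D = noncrossing_pairingsD[OF N(1)]
  have sub: "r \<in> S - {p, q} \<and> s \<in> S - {p, q}" if "{r, s} \<in> N" for r s
    using D(1) that by (auto simp: partition_on_def)
  have "partition_on S M"
    unfolding N(2) using D(1) assms(2) by (auto simp: partition_on_def disjoint_def)
  moreover have "\<forall>e\<in>M. card e = 2" using D(2) N(2) assms(1) by auto
  moreover have "closed_segment a b \<inter> closed_segment c d = {}"
    if edges: "{a, b} \<in> M" "{c, d} \<in> M" "{a, b} \<noteq> {c, d}" for a b c d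
  proof -
    have pq: "closed_segment a b = closed_segment p q" if "{a, b} = {p, q}" for a b
      using that by (auto simp: doubleton_eq_iff closed_segment_commute)
    have "{a, b} = {p, q} \<or> {a, b} \<in> N" "{c, d} = {p, q} \<or> {c, d} \<in> N"
      using edges(1,2) unfolding N(2) insert_iff .
    then consider "{a, b} \<in> N" "{c, d} \<in> N" | "{a, b} = {p, q}" "{c, d} \<in> N"
      | "{a, b} \<in> N" "{c, d} = {p, q}"
      using edges(3) by argo
    then show ?thesis
    proof cases
      case 1
      show ?thesis by (rule D(3)[OF 1 edges(3)])
    next
      case 2
      then show ?thesis using pq[of a b] sep[of c d] sub[of c d] by simp
    next
      case 3
      then show ?thesis using pq[of c d] sep[of a b] sub[of a b] by (simp add: Int_commute)
    qed
  qed
  ultimately have "M \<in> noncrossing_pairings S" by (simp add: noncrossing_pairings_def)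
  then show "M \<in> {M \<in> noncrossing_pairings S. {p, q} \<in> M}" using N(2) by simp
qed

text \<open>The blocks of \<open>M\<close> avoid \<open>p\<close> and \<open>q\<close>. With
  \<open>inj_on_insert_notin\<close> this makes adding the edge injective, so that counts survive
  its deletion.\<close>

lemma edge_notin_noncrossing_pairings_Diff:
  assumes "M \<in> noncrossing_pairings (S - {p, q})"
  shows "{p, q} \<notin> M"
  using noncrossing_pairingsD(1)[OF assms] by (auto simp: partition_on_def)

lemma inj_on_insert_notin: "(\<And>M. M \<in> A \<Longrightarrow> e \<notin> M) \<Longrightarrow> inj_on (insert e) A"
  by (meson inj_onI insert_ident)

text \<open>Otherwise the point at \<open>i + 1\<close> lies inside the segment from
  \<open>i\<close> to \<open>j\<close>, and the edge through that point meets this segment.\<close>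

lemma adjacent_if_paired_on_line:
  assumes M: "M \<in> noncrossing_pairings S" and e: "{(real_of_int i, b::real), (real_of_int j, b)} \<in> M"
    and "i < j" and S: "\<And>l. i < l \<Longrightarrow> l < j \<Longrightarrow> (real_of_int l, b) \<in> S"
  shows "i = j - 1"
proof (rule ccontr)
  assume "i \<noteq> j - 1"
  then have l: "i < i + 1" "i + 1 < j" using \<open>i < j\<close> by auto
  let ?l = "(real_of_int (i + 1), b)"
  obtain s where s: "{?l, s} \<in> M" using noncrossing_pairings_partner[OF M S[OF l]] by metis
  have "?l \<notin> {(real_of_int i, b), (real_of_int j, b)}" using l by auto
  then have "{(real_of_int i, b), (real_of_int j, b)} \<noteq> {?l, s}" by blast
  then have "closed_segment (real_of_int i, b) (real_of_int j, b) \<inter> closed_segment ?l s = {}"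
    by (rule noncrossing_pairingsD(3)[OF M e s])
  moreover have "?l \<in> closed_segment (real_of_int i, b) (real_of_int j, b)"
    using l by (simp add: segment_same_line closed_segment_eq_real_ivl)
  ultimately show False by auto
qed

section \<open>The integer grid and its last edges\<close>

definition grid :: "int \<Rightarrow> int \<Rightarrow> (real \<times> real) set" where
  "grid x y = (\<lambda>i. (real_of_int i, 0)) ` {0..<x} \<union> (\<lambda>j. (real_of_int j, 1)) ` {0..<y}"

lemma of_int_in_grid_iff:
  "(real_of_int i, b) \<in> grid x y \<longleftrightarrow> 0 \<le> i \<and> (b = 0 \<and> i < x \<or> b = 1 \<and> i < y)"
  by (auto simp: grid_def)

lemma in_gridE:
  assumes "p \<in> grid x y"
  obtains i where "p = (of_int i, 0)" "0 \<le> i" "i < x" | j where "p = (of_int j, 1)" "0 \<le> j" "j < y"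
  using assms by (auto simp: grid_def)

lemma finite_grid: "finite (grid x y)"
  by (simp add: grid_def)

text \<open>For a negative argument \<open>grid\<close> merely has an empty line, whereas
  \<open>a_num\<close> is 0 by convention. This is the source of the sign hypotheses in the counting
  lemmas for the bottom and top edges.\<close>

lemma a_num_grid:
  assumes "x \<ge> 0" "y \<ge> 0"
  shows "a_num x y = card (noncrossing_pairings (grid x y))"
proof -
  have "(\<lambda>i. (real i, b)) ` {..<nat z} = (\<lambda>i. (real_of_int i, b)) ` {0..<z}" if "z \<ge> 0" for z and b :: real
  proof -
    have "{0..<z} = int ` {..<nat z}"
      using that image_int_atLeastLessThan[of 0 "nat z"] by (simp add: lessThan_atLeast0)
    then show ?thesis by (simp add: image_image)
  qed
  then show ?thesis using assms by (simp add: a_num_def grid_def)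
qed

lemma snd_grid: "p \<in> grid x y \<Longrightarrow> snd p \<in> {0, 1}"
  by (auto simp: grid_def)

text \<open>The two last points of the lower line. The set is formed for every \<open>x\<close>, but
  for \<open>x < 2\<close> it is not contained in the grid, so no pairing contains it.\<close>

definition bottom_edge :: "int \<Rightarrow> (real \<times> real) set" where
  "bottom_edge x = {(of_int (x - 2), 0), (of_int (x - 1), 0)}"

definition top_edge :: "int \<Rightarrow> (real \<times> real) set" where
  "top_edge y = {(of_int (y - 2), 1), (of_int (y - 1), 1)}"

definition cross_edge :: "int \<Rightarrow> int \<Rightarrow> (real \<times> real) set" where
  "cross_edge x y = {(of_int (x - 1), 0), (of_int (y - 1), 1)}"

lemmas edge_defs = bottom_edge_def top_edge_def cross_edge_def

lemma distinct_last_edges: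
  "bottom_edge x \<noteq> top_edge y" "bottom_edge x \<noteq> cross_edge x y" "top_edge y \<noteq> cross_edge x y"
  by (auto simp: edge_defs doubleton_eq_iff)

text \<open>Any remaining point on the line of \<open>p\<close> or \<open>q\<close> lies to the left
  of that endpoint. Hence a segment between remaining points is \<open>left_of\<close> the edge, and
  \<open>segments_disjoint_iff\<close> gives the separation required for deleting the edge.\<close>

lemma grid_last_edge:
  assumes "{p, q} \<subseteq> grid x y" "p \<noteq> q"
    and left: "\<And>r. r \<in> grid x y - {p, q} \<Longrightarrow> (snd r = snd p \<longrightarrow> fst r < fst p) \<and> (snd r = snd q \<longrightarrow> fst r < fst q)"
  shows "{M \<in> noncrossing_pairings (grid x y). {p, q} \<in> M} =
    insert {p, q} ` noncrossing_pairings (grid x y - {p, q})"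
proof (rule noncrossing_pairings_containing_edge)
  fix r s assume rs: "r \<in> grid x y - {p, q}" "s \<in> grid x y - {p, q}"
  have "left_of r s p q" using left[OF rs(1)] left[OF rs(2)] by (auto simp: left_of_def)
  moreover have "snd p \<in> {0, 1}" "snd q \<in> {0, 1}" "snd r \<in> {0, 1}" "snd s \<in> {0, 1}"
    using snd_grid rs assms(1) by blast+
  ultimately show "closed_segment p q \<inter> closed_segment r s = {}"
    by (simp add: segments_disjoint_iff)
qed (use assms in auto)

lemma grid_Diff_edge:
  "grid x y - bottom_edge x = grid (x - 2) y"
  "grid x y - top_edge y = grid x (y - 2)"
  "grid x y - cross_edge x y = grid (x - 1) (y - 1)"
proof -
  \<comment> \<open>One formula serves all three edges: on the line at height \<open>b\<close> only
    those of the two deleted points that have height \<open>b\<close> are removed.\<close>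
  have *: "(\<lambda>i. (real_of_int i, b)) ` A - {(of_int u, c), (of_int v, d)} =
      (\<lambda>i. (real_of_int i, b)) ` (A - ((if b = c then {u} else {}) \<union> (if b = d then {v} else {})))"
    for A u v and b c d :: real by auto
  have ivl: "{0..<z} - {z - 1, z - 2} = {0..<z - 2}" "{0..<z} - {z - 1} = {0..<z - 1}" for z :: int
    by auto
  show "grid x y - bottom_edge x = grid (x - 2) y" "grid x y - top_edge y = grid x (y - 2)"
    "grid x y - cross_edge x y = grid (x - 1) (y - 1)"
    unfolding grid_def edge_defs Un_Diff * using ivl by simp_all
qed

lemma bottom_edge_pairings:
  assumes "x \<ge> 2"
  shows "{M \<in> noncrossing_pairings (grid x y). bottom_edge x \<in> M} =
    insert (bottom_edge x) ` noncrossing_pairings (grid (x - 2) y)"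
  unfolding grid_Diff_edge(1)[symmetric] unfolding bottom_edge_def
  by (rule grid_last_edge)
    (use assms in \<open>auto simp: of_int_in_grid_iff elim!: in_gridE simp del: of_int_diff\<close>)

lemma top_edge_pairings:
  assumes "y \<ge> 2"
  shows "{M \<in> noncrossing_pairings (grid x y). top_edge y \<in> M} =
    insert (top_edge y) ` noncrossing_pairings (grid x (y - 2))"
  unfolding grid_Diff_edge(2)[symmetric] unfolding top_edge_def
  by (rule grid_last_edge)
    (use assms in \<open>auto simp: of_int_in_grid_iff elim!: in_gridE simp del: of_int_diff\<close>)

lemma cross_edge_pairings:
  assumes "x \<ge> 1" "y \<ge> 1"
  shows "{M \<in> noncrossing_pairings (grid x y). cross_edge x y \<in> M} =
    insert (cross_edge x y) ` noncrossing_pairings (grid (x - 1) (y - 1))"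
  unfolding grid_Diff_edge(3)[symmetric] unfolding cross_edge_def
  by (rule grid_last_edge)
    (use assms in \<open>auto simp: of_int_in_grid_iff elim!: in_gridE simp del: of_int_diff\<close>)

lemma edges_notin_smaller_grid:
  "M \<in> noncrossing_pairings (grid (x - 2) y) \<Longrightarrow> bottom_edge x \<notin> M"
  "M \<in> noncrossing_pairings (grid x (y - 2)) \<Longrightarrow> top_edge y \<notin> M"
  "M \<in> noncrossing_pairings (grid (x - 1) (y - 1)) \<Longrightarrow> cross_edge x y \<notin> M"
  unfolding grid_Diff_edge[symmetric] unfolding edge_defs
  by (rule edge_notin_noncrossing_pairings_Diff, assumption)+

lemma edge_subset:
  "M \<in> noncrossing_pairings S \<Longrightarrow> e \<in> M \<Longrightarrow> e \<subseteq> S"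
  using noncrossing_pairingsD(1) by (fastforce simp: partition_on_def)

lemma edge_in_grid:
  "bottom_edge x \<subseteq> grid x y \<Longrightarrow> x \<ge> 2" "top_edge y \<subseteq> grid x y \<Longrightarrow> y \<ge> 2"
  "cross_edge x y \<subseteq> grid x y \<Longrightarrow> x \<ge> 1 \<and> y \<ge> 1"
  by (auto simp: edge_defs of_int_in_grid_iff simp del: of_int_diff)

section \<open>Counting the pairings that contain given last edges\<close>

lemma card_bottom_edge_pairings:
  assumes "y \<ge> 0"
  shows "card {M \<in> noncrossing_pairings (grid x y). bottom_edge x \<in> M} = a_num (x - 2) y"
proof (cases "x \<ge> 2")
  case True
  then show ?thesis using assms
    by (simp add: bottom_edge_pairings card_image inj_on_insert_notin edges_notin_smaller_grid a_num_grid)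
next
  case False
  \<comment> \<open>For \<open>x < 2\<close> both sides vanish: the edge leaves the grid, and
    \<open>a_num\<close> has the negative argument \<open>x - 2\<close>.\<close>
  then have "{M \<in> noncrossing_pairings (grid x y). bottom_edge x \<in> M} = {}"
    using edge_subset edge_in_grid(1) by blast
  then show ?thesis using False by (simp only: card.empty) (simp add: a_num_def)
qed

lemma card_top_edge_pairings:
  assumes "x \<ge> 0"
  shows "card {M \<in> noncrossing_pairings (grid x y). top_edge y \<in> M} = a_num x (y - 2)"
proof (cases "y \<ge> 2")
  case True
  then show ?thesis using assms
    by (simp add: top_edge_pairings card_image inj_on_insert_notin edges_notin_smaller_grid a_num_grid)
next
  case False
  then have "{M \<in> noncrossing_pairings (grid x y). top_edge y \<in> M} = {}"
    using edge_subset edge_in_grid(2) by blast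
  then show ?thesis using False by (simp only: card.empty) (simp add: a_num_def)
qed

lemma card_cross_edge_pairings:
  "card {M \<in> noncrossing_pairings (grid x y). cross_edge x y \<in> M} = a_num (x - 1) (y - 1)"
proof (cases "x \<ge> 1 \<and> y \<ge> 1")
  case True
  then show ?thesis
    by (simp add: cross_edge_pairings card_image inj_on_insert_notin edges_notin_smaller_grid a_num_grid)
next
  case False
  then have "{M \<in> noncrossing_pairings (grid x y). cross_edge x y \<in> M} = {}"
    using edge_subset edge_in_grid(3) by blast
  then show ?thesis using False by (simp only: card.empty) (auto simp add: a_num_def)
qed

text \<open>The bottom edge is deleted first; what remains is the count for the top edge in the grid
  with \<open>x - 2\<close> lower points, which already covers small \<open>y\<close>.\<close>

lemma card_bottom_top_edge_pairings:
  assumes "x \<ge> 0" "y \<ge> 0"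
  shows "card {M \<in> noncrossing_pairings (grid x y). bottom_edge x \<in> M \<and> top_edge y \<in> M} =
    a_num (x - 2) (y - 2)"
proof (cases "x \<ge> 2")
  case True
  have "{M \<in> noncrossing_pairings (grid x y). bottom_edge x \<in> M \<and> top_edge y \<in> M} =
      {M \<in> {M \<in> noncrossing_pairings (grid x y). bottom_edge x \<in> M}. top_edge y \<in> M}"
    by auto
  \<comment> \<open>The two edges differ, so adding the bottom edge does not change whether the top
    edge is present.\<close>
  also have "\<dots> = insert (bottom_edge x) ` {M \<in> noncrossing_pairings (grid (x - 2) y). top_edge y \<in> M}"
    unfolding bottom_edge_pairings[OF True] Compr_image_eq by (simp add: distinct_last_edges(1)[symmetric])
  finally have eq: "{M \<in> noncrossing_pairings (grid x y). bottom_edge x \<in> M \<and> top_edge y \<in> M} = \<dots>" .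
  have "inj_on (insert (bottom_edge x)) {M \<in> noncrossing_pairings (grid (x - 2) y). top_edge y \<in> M}"
    by (rule inj_on_insert_notin) (blast dest: edges_notin_smaller_grid(1))
  then show ?thesis unfolding eq using card_top_edge_pairings[of "x - 2" y] True
    by (simp add: card_image)
next
  case False
  then have "{M \<in> noncrossing_pairings (grid x y). bottom_edge x \<in> M \<and> top_edge y \<in> M} = {}"
    using edge_subset edge_in_grid(1) by blast
  then show ?thesis using False by (simp only: card.empty) (simp add: a_num_def)
qed

section \<open>Every pairing of a nonempty grid contains a last edge\<close>

lemma bottom_edge_if_paired_on_line:
  assumes M: "M \<in> noncrossing_pairings (grid x y)"
    and e: "{(real_of_int (x - 1), 0), q} \<in> M" and q: "q \<in> grid x y" "q \<noteq> (of_int (x - 1), 0)" "snd q = 0"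
  shows "bottom_edge x \<in> M"
proof -
  obtain i where i: "q = (of_int i, 0)" "0 \<le> i" "i < x" using q(1,3) by (auto elim: in_gridE)
  have "i \<noteq> x - 1" using q(2) i(1) by auto
  \<comment> \<open>The adjacency lemma with \<open>j = x - 1\<close>: the grid has no gaps, so
    every integer position between \<open>i\<close> and \<open>x - 1\<close> is a marked
    point.\<close>
  have "i = x - 1 - 1"
    by (rule adjacent_if_paired_on_line[where b = 0, OF M]) 
      (use e i \<open>i \<noteq> x - 1\<close> in \<open>auto simp: of_int_in_grid_iff insert_commute\<close>)
  then show ?thesis using e i by (simp add: bottom_edge_def insert_commute)
qed

lemma top_edge_if_paired_on_line:
  assumes M: "M \<in> noncrossing_pairings (grid x y)"
    and e: "{(real_of_int (y - 1), 1), q} \<in> M" and q: "q \<in> grid x y" "q \<noteq> (of_int (y - 1), 1)" "snd q = 1"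
  shows "top_edge y \<in> M"
proof -
  obtain i where i: "q = (of_int i, 1)" "0 \<le> i" "i < y" using q(1,3) by (auto elim: in_gridE)
  have "i \<noteq> y - 1" using q(2) i(1) by auto
  have "i = y - 1 - 1"
    by (rule adjacent_if_paired_on_line[where b = 1, OF M]) 
      (use e i \<open>i \<noteq> y - 1\<close> in \<open>auto simp: of_int_in_grid_iff insert_commute\<close>)
  then show ?thesis using e i by (simp add: top_edge_def insert_commute)
qed

text \<open>Without a last edge both last points are joined to the opposite line, but not to each
  other, and these two segments cross.\<close>

lemma last_edge_cases:
  assumes M: "M \<in> noncrossing_pairings (grid x y)" and xy: "x \<ge> 0" "y \<ge> 0" "x + y > 0"
  shows "bottom_edge x \<in> M \<or> top_edge y \<in> M \<or> cross_edge x y \<in> M"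
proof (rule ccontr)
  assume no: "\<not> ?thesis"
  let ?p = "(real_of_int (x - 1), 0::real)" and ?t = "(real_of_int (y - 1), 1::real)"
  have bottom: "\<exists>q. {?p, q} \<in> M \<and> q \<in> grid x y \<and> snd q = 1" if "x > 0"
  proof -
    have "?p \<in> grid x y" using that by (auto simp: of_int_in_grid_iff simp del: of_int_diff)
    then obtain q where q: "{?p, q} \<in> M" "q \<in> grid x y" "q \<noteq> ?p"
      using noncrossing_pairings_partner[OF M] by metis
    then show ?thesis using bottom_edge_if_paired_on_line[OF M q] no snd_grid by blast
  qed
  have top: "\<exists>q. {?t, q} \<in> M \<and> q \<in> grid x y \<and> snd q = 0" if "y > 0"
  proof -
    have "?t \<in> grid x y" using that by (auto simp: of_int_in_grid_iff simp del: of_int_diff)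
    then obtain q where q: "{?t, q} \<in> M" "q \<in> grid x y" "q \<noteq> ?t"
      using noncrossing_pairings_partner[OF M] by metis
    then show ?thesis using top_edge_if_paired_on_line[OF M q] no snd_grid by blast
  qed
  \<comment> \<open>A partner on the opposite line shows that this line is nonempty, so
    \<open>x + y > 0\<close> yields points on both lines.\<close>
  have "y > 0" if "x > 0" using bottom[OF that] by (auto elim: in_gridE)
  moreover have "x > 0" if "y > 0" using top[OF that] by (auto elim: in_gridE)
  ultimately have "x > 0" "y > 0" using xy by linarith+
  then obtain q u where q: "{?p, q} \<in> M" "q \<in> grid x y" "snd q = 1"
    and u: "{?t, u} \<in> M" "u \<in> grid x y" "snd u = 0"
    using bottom top by blast
  have "q \<noteq> ?t" using no q(1) by (auto simp: cross_edge_def)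
  have ne: "{?p, q} \<noteq> {?t, u}"
    using \<open>q \<noteq> ?t\<close> by (auto simp: doubleton_eq_iff)
  obtain j where j: "q = (of_int j, 1)" "j < y" using q by (auto elim: in_gridE)
  obtain i where i: "u = (of_int i, 0)" "i < x" using u by (auto elim: in_gridE)
  have "closed_segment ?p q \<inter> closed_segment u ?t = {}"
    using noncrossing_pairingsD(3)[OF M q(1) u(1) ne] by (simp add: closed_segment_commute)
  \<comment> \<open>Disjoint segments must be ordered the same way on both lines. Each alternative
    puts a marked point beyond the last one: \<open>i > x - 1\<close> or
    \<open>j > y - 1\<close>.\<close>
  then have "real_of_int (x - 1) < of_int i \<and> real_of_int j < of_int (y - 1)
      \<or> real_of_int i < of_int (x - 1) \<and> real_of_int (y - 1) < of_int j"
    unfolding i j two_lines_disjoint_iff .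
  then show False using i j by linarith
qed

section \<open>Inclusion-exclusion over the last edges\<close>

lemma a_num_negative: "x < 0 \<or> y < 0 \<Longrightarrow> a_num x y = 0"
  by (auto simp: a_num_def)

text \<open>The overlap term stands on the left to avoid truncated subtraction. At
  \<open>x = y = 0\<close> the equation would read 1 = 0, because the empty pairing has no last
  edge. If \<open>x\<close> or \<open>y\<close> is negative, all five terms vanish.\<close>

lemma a_num_recurrence:
  assumes "x + y > 0"
  shows "a_num x y + a_num (x - 2) (y - 2) = a_num (x - 2) y + a_num x (y - 2) + a_num (x - 1) (y - 1)"
proof (cases "x \<ge> 0 \<and> y \<ge> 0")
  case False
  then show ?thesis by (auto simp: a_num_negative)
next
  case True
  let ?N = "noncrossing_pairings (grid x y)"
  define B T C where "B = {M \<in> ?N. bottom_edge x \<in> M}" and "T = {M \<in> ?N. top_edge y \<in> M}"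
    and "C = {M \<in> ?N. cross_edge x y \<in> M}"
  have fin: "finite ?N" by (simp add: finite_noncrossing_pairings finite_grid)
  then have fins: "finite B" "finite T" "finite C" by (auto simp: B_def T_def C_def)
  have N: "?N = (B \<union> T) \<union> C"
    using last_edge_cases assms True by (auto simp: B_def T_def C_def)
  \<comment> \<open>The cross edge shares an endpoint with each of the other two last edges, so only
    \<open>B\<close> and \<open>T\<close> can overlap.\<close>
  have False if "M \<in> ?N" "cross_edge x y \<in> M" "bottom_edge x \<in> M \<or> top_edge y \<in> M" for M
    using noncrossing_pairings_common_point[OF that(1) _ that(2), of "bottom_edge x" "(of_int (x - 1), 0)"]
      noncrossing_pairings_common_point[OF that(1) _ that(2), of "top_edge y" "(of_int (y - 1), 1)"]
      that(3) distinct_last_edges by (auto simp: edge_defs)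
  then have disj: "(B \<union> T) \<inter> C = {}" by (auto simp: B_def T_def C_def)
  have "card ?N = card (B \<union> T) + card C"
    unfolding N using fins disj by (simp add: card_Un_disjoint)
  moreover have "card (B \<union> T) + card (B \<inter> T) = card B + card T"
    using card_Un_Int[OF fins(1,2)] by simp
  moreover have "B \<inter> T = {M \<in> ?N. bottom_edge x \<in> M \<and> top_edge y \<in> M}"
    by (auto simp: B_def T_def)
  ultimately show ?thesis
    using card_bottom_edge_pairings[of y x] card_top_edge_pairings[of x y] card_cross_edge_pairings[of x y]
      card_bottom_top_edge_pairings[of x y] a_num_grid[of x y] True by (simp add: B_def T_def C_def)
qed

section \<open>The recurrence for paths\<close>

text \<open>Every step advances the first coordinate by 1. This yields finiteness of the path sets
  and excludes paths with \<open>k < 0\<close>.\<close>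

lemma length_peakless_motzkin_path:
  assumes "w \<in> peakless_motzkin_paths k n"
  shows "int (length w) = k"
proof -
  have "fst (sum_list w) = int (length w)" if "set w \<subseteq> {(1, 0), (1, 1), (1, -1)}" for w :: "(int \<times> int) list"
    using that by (induction w) auto
  from this[of w] show ?thesis using assms by (simp add: peakless_motzkin_paths_def)
qed

lemma finite_peakless_motzkin_paths: "finite (peakless_motzkin_paths k n)"
proof (rule finite_subset)
  show "peakless_motzkin_paths k n \<subseteq> {w. set w \<subseteq> {(1, 0), (1, 1), (1, -1)} \<and> length w = nat k}"
  proof
    fix w assume w: "w \<in> peakless_motzkin_paths k n"
    show "w \<in> {w. set w \<subseteq> {(1, 0), (1, 1), (1, -1)} \<and> length w = nat k}"
      using w length_peakless_motzkin_path[OF w] by (auto simp: peakless_motzkin_paths_def)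
  qed
qed (simp add: finite_lists_length_eq)

lemma Nil_in_peakless_motzkin_paths: "[] \<in> peakless_motzkin_paths k n \<longleftrightarrow> k = 0 \<and> n = 0"
  by (auto simp: peakless_motzkin_paths_def zero_prod_def)

text \<open>A peak of \<open>s # w\<close> either sits at index 0, formed by \<open>s\<close> and
  the head of \<open>w\<close>, or is a peak of \<open>w\<close> shifted by one.\<close>

lemma Cons_in_peakless_motzkin_paths:
  "s # w \<in> peakless_motzkin_paths k n \<longleftrightarrow> s \<in> {(1, 0), (1, 1), (1, -1)} \<and>
    w \<in> peakless_motzkin_paths (k - fst s) (n - snd s) \<and> \<not> (s = (1, 1) \<and> (\<exists>v. w = (1, -1) # v))"
proof -
  have "(\<exists>i. Suc i < length (s # w) \<and> (s # w) ! i = (1, 1) \<and> (s # w) ! Suc i = (1, -1)) \<longleftrightarrow>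
      s = (1, 1) \<and> (\<exists>v. w = (1, -1) # v) \<or>
      (\<exists>i. Suc i < length w \<and> w ! i = (1, 1) \<and> w ! Suc i = (1, -1))"
    (is "(\<exists>i. ?P i) \<longleftrightarrow> _")
  proof -
    have "(\<exists>i. ?P i) \<longleftrightarrow> ?P 0 \<or> (\<exists>i. ?P (Suc i))" by (metis not0_implies_Suc)
    also have "?P 0 \<longleftrightarrow> s = (1, 1) \<and> (\<exists>v. w = (1, -1) # v)" by (cases w) auto
    finally show ?thesis by simp
  qed
  moreover have "sum_list (s # w) = (k, n) \<longleftrightarrow> sum_list w = (k - fst s, n - snd s)"
    by (cases s; cases "sum_list w") auto
  ultimately show ?thesis unfolding peakless_motzkin_paths_def mem_Collect_eq by auto
qed

lemma m_num_recurrence: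
  assumes "k > 0"
  shows "m_num k n + m_num (k - 2) n = m_num (k - 1) n + m_num (k - 1) (n - 1) + m_num (k - 1) (n + 1)"
proof -
  let ?P = peakless_motzkin_paths
  \<comment> \<open>The paths to \<open>(k - 1, n - 1)\<close> that start with a down step; exactly
    these cannot follow an up step.\<close>
  let ?D = "(#) (1, -1) ` ?P (k - 2) n"
  define A B C where "A = (#) (1, 0) ` ?P (k - 1) n" and "B = (#) (1, 1) ` (?P (k - 1) (n - 1) - ?D)"
    and "C = (#) (1, -1) ` ?P (k - 1) (n + 1)"
  \<comment> \<open>Classification by the first step: level in \<open>A\<close>, up in
    \<open>B\<close>, down in \<open>C\<close>. The empty path is excluded by
    \<open>k > 0\<close>.\<close>
  have "w \<in> ?P k n \<longleftrightarrow> w \<in> A \<union> B \<union> C" for w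
    using assms by (cases w)
      (auto simp: A_def B_def C_def Nil_in_peakless_motzkin_paths Cons_in_peakless_motzkin_paths image_iff)
  then have "?P k n = A \<union> B \<union> C" by blast
  moreover have "finite A" "finite B" "finite C"
    by (auto simp: A_def B_def C_def finite_peakless_motzkin_paths)
  moreover have "A \<inter> B = {}" "(A \<union> B) \<inter> C = {}" by (auto simp: A_def B_def C_def)
  ultimately have "card (?P k n) = card A + card B + card C" by (simp add: card_Un_disjoint)
  moreover have "card A = m_num (k - 1) n" "card C = m_num (k - 1) (n + 1)"
    by (simp_all add: A_def C_def m_num_def card_image)
  moreover have "card B + m_num (k - 2) n = m_num (k - 1) (n - 1)"
  proof -
    \<comment> \<open>Prepending a down step never creates a peak. The inclusion also makes the
      difference of cardinalities below an honest subtraction.\<close>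
    have D: "?D \<subseteq> ?P (k - 1) (n - 1)" by (auto simp: Cons_in_peakless_motzkin_paths)
    have "card ?D \<le> card (?P (k - 1) (n - 1))"
      by (rule card_mono[OF finite_peakless_motzkin_paths D])
    moreover have "card B = card (?P (k - 1) (n - 1)) - card ?D"
      using D by (simp add: B_def card_image card_Diff_subset finite_peakless_motzkin_paths)
    ultimately show ?thesis by (simp add: m_num_def card_image)
  qed
  ultimately show ?thesis by (simp add: m_num_def)
qed

section \<open>Boundary values and the induction\<close>

lemma m_num_negative: "k < 0 \<Longrightarrow> m_num k n = 0"
  using length_peakless_motzkin_path by (fastforce simp: m_num_def card_eq_0_iff)

lemma m_num_0: "m_num 0 n = (if n = 0 then 1 else 0)"
proof -
  have "w \<in> peakless_motzkin_paths 0 n \<longleftrightarrow> n = 0 \<and> w = []" for w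
    using length_peakless_motzkin_path[of w 0 n] Nil_in_peakless_motzkin_paths[of 0 n] by auto
  then have "peakless_motzkin_paths 0 n = (if n = 0 then {[]} else {})" by auto
  then show ?thesis by (simp add: m_num_def)
qed

lemma a_num_0_0: "a_num 0 0 = 1"
proof -
  have "noncrossing_pairings {} = {{} :: (real \<times> real) set set}"
    by (auto simp: noncrossing_pairings_def partition_on_empty)
  then show ?thesis by (simp add: a_num_def)
qed

text \<open>Negative \<open>k\<close> is included because the recurrence at \<open>k = 1\<close>
  reaches \<open>k - 2 = -1\<close>. In that range \<open>(k - n) + (k + n) = 2 * k < 0\<close>, so
  one argument of \<open>a_num\<close> is negative.\<close>

lemma m_num_eq_a_num: "m_num k n = a_num (k - n) (k + n)"
proof (induction "nat k" arbitrary: k n rule: less_induct)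
  case less
  consider "k < 0" | "k = 0" | "k > 0" by linarith
  then show ?case
  proof cases
    case 1
    then have "k - n < 0 \<or> k + n < 0" by linarith
    then show ?thesis using 1 by (simp add: a_num_negative m_num_negative)
  next
    case 2
    have "n = 0 \<or> - n < 0 \<or> n < 0" by linarith
    then show ?thesis using 2 a_num_negative[of "- n" n] by (auto simp: m_num_0 a_num_0_0)
  next
    case 3
    \<comment> \<open>Under \<open>x = k - n\<close> and \<open>y = k + n\<close> the four smaller
      path counts become the four smaller terms of \<open>a_num_recurrence\<close>, whose hypothesis
      reads \<open>2 * k > 0\<close>.\<close>
    have IH: "m_num (k - 2) n = a_num (k - n - 2) (k + n - 2)"
      "m_num (k - 1) n = a_num (k - n - 1) (k + n - 1)"
      "m_num (k - 1) (n - 1) = a_num (k - n) (k + n - 2)"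
      "m_num (k - 1) (n + 1) = a_num (k - n - 2) (k + n)"
      using less[of "k - 2" n] less[of "k - 1" n] less[of "k - 1" "n - 1"] less[of "k - 1" "n + 1"] 3
      by (simp_all add: algebra_simps)
    show ?thesis
      using m_num_recurrence[OF 3, of n] a_num_recurrence[of "k - n" "k + n"] 3 unfolding IH by simp
  qed
qed

theorem theorem1:
  fixes k n :: int
  assumes "k \<ge> 0"
  shows "m_num k n = a_num (k - n) (k + n)"
  by (rule m_num_eq_a_num)

end
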